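(* Let $W\ge1$ be an integer and let $\epsilon>0$ be such that $k=\frac{1}{2\epsilon}$ and $\frac{W}{k}$ are integers. Then Algorithm 1 (described in the context, run with these parameters) requires $$\frac{1}{2\epsilon}+2\log W+O(1)$$ bits of memory.
   Context: All logarithms are base 2, and $O(1)$ denotes a quantity bounded by an absolute constant. The memory of the algorithm is the number of bits used to store its variables. Algorithm 1. Variables: integers $y,m,i,B$ and a bit array $b=(b_0,\dots,b_{k-1})$, all initialized to $0$. Add(bit $x$): If $m=\frac Wk-1$, then do in order: (1) $B\leftarrow B-b_i$; (2) if $y+x\ge\frac Wk$, set $b_i\leftarrow1$ and $y\leftarrow y-\frac Wk+x$; otherwise set $b_i\leftarrow0$ and $y\leftarrow y+x$; (3) $B\leftarrow B+b_i$; (4) $m\leftarrow0$; (5) $i\leftarrow i+1 \bmod k$. Otherwise (if $m\neq\frac Wk-1$): $y\leftarrow y+x$ and $m\leftarrow m+1$. Query: return $\frac Wk\cdot B+y-\frac{W}{2k}-m\cdot b_i$. Each arriving bit of the input stream is processed by one call of Add. The variables $y,m,i,B$ are stored as binary integers with enough bits for their ranges, and $b$ is stored as $k$ bits. *)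

theory Defs
  imports Complex_Main "HOL-Library.Extended_Nat"
begin

record state =
  var_y :: int
  var_m :: int
  var_i :: int
  var_B :: int
  var_b :: "bool list"

definition init :: "nat \<Rightarrow> state" where
  "init k = \<lparr>var_y = 0, var_m = 0, var_i = 0, var_B = 0, var_b = replicate k False\<rparr>"

abbreviation cur_bit :: "state \<Rightarrow> bool" where
  "cur_bit s \<equiv> var_b s ! nat (var_i s)"

(* W div k is the exact quotient W/k, as the algorithm is only run when k divides W. *)
abbreviation block :: "nat \<Rightarrow> nat \<Rightarrow> int" where
  "block W k \<equiv> int (W div k)"

(* All states passed through by one call of Add, in order; values that a variable
   holds only in the middle of a call also have to be stored. *)
definition add_trace :: "nat \<Rightarrow> nat \<Rightarrow> bool \<Rightarrow> state \<Rightarrow> state list" where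
  "add_trace W k x s =
    (if var_m s = block W k - 1 then
       let s1 = s\<lparr>var_B := var_B s - of_bool (cur_bit s)\<rparr>;
           s2 = (if var_y s1 + of_bool x \<ge> block W k
                 then s1\<lparr>var_b := (var_b s1)[nat (var_i s1) := True],
                         var_y := var_y s1 - block W k + of_bool x\<rparr>
                 else s1\<lparr>var_b := (var_b s1)[nat (var_i s1) := False],
                         var_y := var_y s1 + of_bool x\<rparr>);
           s3 = s2\<lparr>var_B := var_B s2 + of_bool (cur_bit s2)\<rparr>;
           s4 = s3\<lparr>var_m := 0\<rparr>;
           s5 = s4\<lparr>var_i := (var_i s4 + 1) mod int k\<rparr>
       in [s1, s2, s3, s4, s5]
     else
       let s1 = s\<lparr>var_y := var_y s + of_bool x\<rparr>;
           s2 = s1\<lparr>var_m := var_m s1 + 1\<rparr>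
       in [s1, s2])"

definition add :: "nat \<Rightarrow> nat \<Rightarrow> bool \<Rightarrow> state \<Rightarrow> state" where
  "add W k x s = last (add_trace W k x s)"

(* Query only reads the variables, so it does not affect their ranges. *)
definition query :: "nat \<Rightarrow> nat \<Rightarrow> state \<Rightarrow> real" where
  "query W k s = real W / real k * of_int (var_B s) + of_int (var_y s)
     - real W / (2 * real k) - of_int (var_m s) * of_bool (cur_bit s)"

definition run :: "nat \<Rightarrow> nat \<Rightarrow> bool list \<Rightarrow> state" where
  "run W k xs = fold (add W k) xs (init k)"

definition visited :: "nat \<Rightarrow> nat \<Rightarrow> state set" where
  "visited W k = {init k} \<union> (\<Union>xs x. set (add_trace W k x (run W k xs)))"

(* The least width of an unsigned binary field able to hold every value in S;
   it is infinite if S is unbounded or contains a negative number. *)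
definition field_width :: "int set \<Rightarrow> enat" where
  "field_width S = (INF n \<in> {n. S \<subseteq> {0..<2 ^ n}}. enat n)"

definition memory_bits :: "nat \<Rightarrow> nat \<Rightarrow> enat" where
  "memory_bits W k =
     field_width (var_y ` visited W k) + field_width (var_m ` visited W k)
     + field_width (var_i ` visited W k) + field_width (var_B ` visited W k)
     + enat k"

end

(* With n = W/k, the field y takes values in [0, 2n - 2], m in [0, n - 1], i in [0, k - 1] and
   B, which is the number of ones in b, in [0, k].  On the all-ones stream y and m reach n - 1,
   i reaches k - 1 and B reaches k.  So the four fields take log n, log n, log k and log k bits
   up to O(1), which together is 2 log W, and b takes k bits. *)
theory Submission imports Defs begin

text \<open>With \<open>w\<close> bits the value \<open>v\<close> forces c \<le> 2^w, which bounds
  \<open>w\<close> below. As \<open>w\<close> is least, some element of \<open>S\<close> is at least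
  2^(w - 1), and it is at most 2 * c, so w - 1 \<le> 1 + log c. The slack between c - 1 and 2 * c
  lets one lemma serve all four fields.\<close>

lemma field_width_log:
  fixes u v c :: int
  assumes S: "S \<subseteq> {0..u}" and v: "v \<in> S" and c: "c \<ge> 1" and vc: "c - 1 \<le> v" and uc: "u \<le> 2 * c"
  obtains w where "field_width S = enat w" "\<bar>real w - log 2 (real_of_int c)\<bar> \<le> 2"
proof -
  let ?P = "\<lambda>n::nat. S \<subseteq> {0..<2 ^ n}"
  define w where "w = (LEAST n. ?P n)"
  \<comment> \<open>Some finite width suffices, so \<open>LEAST\<close> is meaningful and the
    infimum is not infinite.\<close>
  have "int (nat u) < 2 ^ nat u"
    by (rule of_nat_less_two_power)
  then have "?P (nat u)"
    using S by fastforce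
  then have Pw: "?P w"
    unfolding w_def by (rule LeastI)
  have least: "w \<le> n" if "?P n" for n
    unfolding w_def using that by (rule Least_le)
  have "field_width S = enat w"
    unfolding field_width_def
    by (rule antisym) (use Pw least in \<open>auto intro!: INF_lower INF_greatest\<close>)
  moreover have "log 2 c \<le> w"
  proof -
    have "c \<le> 2 ^ w"
      using Pw v vc by force
    then have "real_of_int c \<le> 2 ^ w"
      by (metis of_int_le_iff of_int_numeral of_int_power)
    then show ?thesis
      using c by (simp add: log_le_iff powr_realpow)
  qed
  moreover have "w \<le> log 2 c + 2"
  proof (cases w)
    case 0
    then show ?thesis using c by (simp add: add_nonneg_nonneg)
  next
    case (Suc p)
    then have "\<not> ?P p"
      using least[of p] by auto
    then obtain s where "s \<in> S" "2 ^ p \<le> s"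
      using S by force
    then have "2 ^ p \<le> 2 * c"
      using S uc by force
    then have "2 ^ p \<le> 2 * real_of_int c"
      by (metis of_int_le_iff of_int_mult of_int_numeral of_int_power)
    then have "real p \<le> log 2 (2 * c)"
      using c by (simp add: le_log_iff powr_realpow)
    then show ?thesis
      using Suc c by (simp add: log_mult)
  qed
  ultimately show ?thesis
    using that by simp
qed

definition ones :: "bool list \<Rightarrow> int" where
  "ones b = int (count_list b True)"

lemma ones_bounds: "0 \<le> ones b" "ones b \<le> int (length b)"
  by (simp_all add: ones_def count_le_length)

lemma ones_update:
  "j < length b \<Longrightarrow> ones (b[j := v]) = ones b - of_bool (b ! j) + of_bool v"
proof (induction b arbitrary: j)
  case (Cons a b)
  have "ones (x # xs) = of_bool x + ones xs" for x xs
    by (simp add: ones_def)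
  then show ?case
    using Cons by (auto split: nat.splits)
qed simp

text \<open>Unlike \<open>consistent\<close>, this also has to hold in the middle of a call, where
  \<open>var_B\<close> may lack the current bit and \<open>var_y\<close> may have grown before
  \<open>var_m\<close>.\<close>

definition in_range :: "nat \<Rightarrow> nat \<Rightarrow> state \<Rightarrow> bool" where
  "in_range n k s \<longleftrightarrow> var_y s \<in> {0..2 * int n} \<and> var_m s \<in> {0..int n - 1} \<and>
     var_i s \<in> {0..int k - 1} \<and> var_B s \<in> {0..int k}"

text \<open>Only \<open>y < n + m\<close> is inductive; the bound on \<open>y\<close> in \<^const>\<open>in_range\<close> is not preserved by itself.\<close>

definition consistent :: "nat \<Rightarrow> nat \<Rightarrow> state \<Rightarrow> bool" where
  "consistent n k s \<longleftrightarrow> 0 \<le> var_y s \<and> var_y s < int n + var_m s \<and> var_m s \<in> {0..int n - 1} \<and>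
     var_i s \<in> {0..int k - 1} \<and> length (var_b s) = k \<and> var_B s = ones (var_b s)"

lemma consistent_in_range: "consistent n k s \<Longrightarrow> in_range n k s"
  using ones_bounds[of "var_b s"] by (auto simp: consistent_def in_range_def)

lemma consistent_init: "n \<ge> 1 \<Longrightarrow> k \<ge> 1 \<Longrightarrow> consistent n k (init k)"
  by (auto simp: consistent_def init_def ones_def count_list_0_iff)

text \<open>When a block closes, m = n - 1 and so y + x < 2n. Either y + x < n already or
  subtracting n makes it so, which fits the reset m = 0. Inside a block, m grows by one and y by at
  most one.\<close>

lemma add_step:
  assumes "consistent (W div k) k s"
  shows consistent_add: "consistent (W div k) k (add W k x s)"
    and in_range_trace: "\<forall>t \<in> set (add_trace W k x s). in_range (W div k) k t"
proof -
  let ?j = "nat (var_i s)"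
  have j: "?j < length (var_b s)" and k: "int k > 0"
    using assms by (auto simp: consistent_def)
  have len: "length (var_b s) = k" and B: "var_B s = ones (var_b s)"
    using assms by (auto simp: consistent_def)
  note upd = ones_update[OF j]
  have bnd: "0 \<le> ones ((var_b s)[?j := v])" "ones ((var_b s)[?j := v]) \<le> int k" for v
    using ones_bounds[of "(var_b s)[?j := v]"] len by auto
  \<comment> \<open>The values of \<open>var_B\<close> during a closing call count the ones of the
    array with the current bit cleared or set, hence stay in [0, k].\<close>
  have bnds: "0 \<le> ones (var_b s) - of_bool (cur_bit s)" "ones (var_b s) - of_bool (cur_bit s) \<le> int k"
    "0 \<le> ones (var_b s) - of_bool (cur_bit s) + 1" "ones (var_b s) - of_bool (cur_bit s) + 1 \<le> int k"
    using bnd[of False] bnd[of True] by (auto simp: upd)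
  have i: "0 \<le> (var_i s + 1) mod int k" "(var_i s + 1) mod int k \<le> int k - 1"
    using k by (auto simp: pos_mod_bound)
  show "consistent (W div k) k (add W k x s)"
    using assms i j bnds
    by (auto simp: consistent_def add_def add_trace_def Let_def upd split: if_splits)
  show "\<forall>t \<in> set (add_trace W k x s). in_range (W div k) k t"
    using assms i j bnds ones_bounds[of "var_b s"]
    by (auto simp: consistent_def in_range_def add_trace_def Let_def split: if_splits)
qed

lemma consistent_run:
  assumes "W div k \<ge> 1" "k \<ge> 1"
  shows "consistent (W div k) k (run W k xs)"
  by (induction xs rule: rev_induct)
    (use assms consistent_init consistent_add in \<open>auto simp: run_def\<close>)

lemma visited_in_range:
  assumes "W div k \<ge> 1" "k \<ge> 1" "s \<in> visited W k"
  shows "in_range (W div k) k s"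
  using assms consistent_run consistent_init consistent_in_range in_range_trace
  unfolding visited_def by fast

lemma run_in_visited: "run W k xs \<in> visited W k"
proof (cases xs rule: rev_cases)
  case Nil
  then show ?thesis by (simp add: run_def visited_def)
next
  case (snoc ys x)
  have "add_trace W k x s \<noteq> []" for s
    by (simp add: add_trace_def Let_def)
  then have "run W k xs \<in> set (add_trace W k x (run W k ys))"
    using snoc by (simp add: run_def add_def)
  then show ?thesis
    unfolding visited_def by blast
qed

text \<open>The state on the all-ones stream after \<open>q\<close> full blocks and \<open>r\<close>
  more bits, for q \<le> k. The \<open>mod\<close> matters only at q = k, where the index has
  wrapped to 0.\<close>

definition ones_state :: "nat \<Rightarrow> nat \<Rightarrow> nat \<Rightarrow> state" where
  "ones_state k q r = \<lparr>var_y = int r, var_m = int r, var_i = int q mod int k, var_B = int q,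
     var_b = map (\<lambda>j. j < q) [0..<k]\<rparr>"

text \<open>Since q < k, slot \<open>q\<close> still holds 0, so nothing is taken from
  \<open>var_B\<close>. At the end of a block y + 1 = n, which sets the slot and returns y to
  0.\<close>

lemma add_ones_state:
  assumes "W div k \<ge> 1" "q < k"
  shows "Suc r < W div k \<Longrightarrow> add W k True (ones_state k q r) = ones_state k q (Suc r)"
    and "Suc r = W div k \<Longrightarrow> add W k True (ones_state k q r) = ones_state k (Suc q) 0"
proof -
  have "(map (\<lambda>j. j < q) [0..<k])[q := True] = map (\<lambda>j. j < Suc q) [0..<k]"
    using \<open>q < k\<close> by (intro nth_equalityI) (auto simp: nth_list_update)
  then show "Suc r = W div k \<Longrightarrow> add W k True (ones_state k q r) = ones_state k (Suc q) 0"
    using assms by (auto simp: add_def add_trace_def Let_def ones_state_def add.commute)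
qed (use assms in \<open>auto simp: add_def add_trace_def Let_def ones_state_def\<close>)

text \<open>The second claim is not just r = 0 in the first: it includes q = k, the state with every
  bit set.\<close>

lemma run_ones:
  assumes n: "W div k \<ge> 1"
  shows "q < k \<Longrightarrow> r < W div k \<Longrightarrow> run W k (replicate (q * (W div k) + r) True) = ones_state k q r"
    and "q \<le> k \<Longrightarrow> run W k (replicate (q * (W div k)) True) = ones_state k q 0"
proof -
  \<comment> \<open>The extra bit is moved to the end of the list, where \<open>fold\<close>
    processes it last.\<close>
  have step: "run W k (replicate (Suc t) True) = add W k True (run W k (replicate t True))" for t
    by (simp add: run_def replicate_append_same[symmetric] del: replicate_append_same)
  have row: "run W k (replicate (q * (W div k) + r) True) = ones_state k q r"
    if "run W k (replicate (q * (W div k)) True) = ones_state k q 0" "q < k" "r < W div k" for q r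
    using that(3)
  proof (induction r)
    case (Suc r)
    then show ?case
      using step[of "q * (W div k) + r"] add_ones_state(1)[OF n \<open>q < k\<close>] by simp
  qed (use that in simp)
  have start: "q \<le> k \<Longrightarrow> run W k (replicate (q * (W div k)) True) = ones_state k q 0" for q
  proof (induction q)
    case 0
    show ?case
      by (simp add: run_def init_def ones_state_def map_replicate_const)
  next
    case (Suc q)
    \<comment> \<open>The block is split into n - 1 bits that only raise \<open>r\<close> and one
      bit that closes it.\<close>
    obtain p where p: "W div k = Suc p"
      using n by (cases "W div k") auto
    have eq: "Suc q * (W div k) = Suc (q * (W div k) + p)"
      using p by simp
    have "run W k (replicate (q * (W div k) + p) True) = ones_state k q p"
      using row[of q p] Suc p by simp
    then show ?case
      unfolding eq step using add_ones_state(2)[OF n, of q p] Suc.prems p by simp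
  qed
  show "q < k \<Longrightarrow> r < W div k \<Longrightarrow> run W k (replicate (q * (W div k) + r) True) = ones_state k q r"
    using row start by simp
  show "q \<le> k \<Longrightarrow> run W k (replicate (q * (W div k)) True) = ones_state k q 0"
    by (rule start)
qed

lemma memory_bits_log:
  assumes n: "W div k \<ge> 1" and k: "k \<ge> 1"
  obtains M where "memory_bits W k = enat M"
    "\<bar>real M - (real k + 2 * log 2 (real (W div k)) + 2 * log 2 (real k))\<bar> \<le> 8"
proof -
  let ?n = "W div k"
  have range: "var_y ` visited W k \<subseteq> {0..2 * int ?n}" "var_m ` visited W k \<subseteq> {0..int ?n - 1}"
    "var_i ` visited W k \<subseteq> {0..int k - 1}" "var_B ` visited W k \<subseteq> {0..int k}"
    using visited_in_range[OF n k] unfolding in_range_def by blast+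
  \<comment> \<open>The first state makes y and m large, the second i, the third B.\<close>
  have "ones_state k 0 (?n - 1) \<in> visited W k" "ones_state k (k - 1) 0 \<in> visited W k"
    "ones_state k k 0 \<in> visited W k"
    using run_ones(1)[OF n, of 0 "?n - 1"] run_ones(2)[OF n, of "k - 1"] run_ones(2)[OF n, of k]
      run_in_visited n k by (metis diff_le_self diff_less le_refl less_le_trans zero_less_one)+
  from this[THEN imageI, of var_y] this[THEN imageI, of var_m] this[THEN imageI, of var_i]
    this[THEN imageI, of var_B]
  have reach: "int ?n - 1 \<in> var_y ` visited W k" "int ?n - 1 \<in> var_m ` visited W k"
    "int k - 1 \<in> var_i ` visited W k" "int k \<in> var_B ` visited W k"
    using n k by (simp_all add: ones_state_def of_nat_diff zmod_minus1)
  obtain wy where "field_width (var_y ` visited W k) = enat wy" "\<bar>real wy - log 2 ?n\<bar> \<le> 2"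
    using field_width_log[OF range(1) reach(1), of "int ?n"] n by auto
  moreover obtain wm where "field_width (var_m ` visited W k) = enat wm" "\<bar>real wm - log 2 ?n\<bar> \<le> 2"
    using field_width_log[OF range(2) reach(2), of "int ?n"] n by auto
  moreover obtain wi where "field_width (var_i ` visited W k) = enat wi" "\<bar>real wi - log 2 k\<bar> \<le> 2"
    using field_width_log[OF range(3) reach(3), of "int k"] k by auto
  moreover obtain wB where "field_width (var_B ` visited W k) = enat wB" "\<bar>real wB - log 2 k\<bar> \<le> 2"
    using field_width_log[OF range(4) reach(4), of "int k"] k by auto
  \<comment> \<open>Each of the four fields contributes an error of at most 2, whence 8; the array
    is counted exactly.\<close>
  ultimately show ?thesis
    by (intro that[of "wy + wm + wi + wB + k"]) (simp_all add: memory_bits_def)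
qed

theorem theorem8:
  "\<exists>C::real. \<forall>(W::nat) (k::nat) (\<epsilon>::real).
     W \<ge> 1 \<longrightarrow> \<epsilon> > 0 \<longrightarrow> real k = 1 / (2 * \<epsilon>) \<longrightarrow> real W / real k \<in> \<int> \<longrightarrow>
     (\<exists>M::nat. memory_bits W k = enat M \<and>
        \<bar>real M - (1 / (2 * \<epsilon>) + 2 * log 2 (real W))\<bar> \<le> C)"
proof (rule exI[of _ 8], intro allI impI)
  fix W k :: nat and \<epsilon> :: real
  assume W: "W \<ge> 1" and "\<epsilon> > 0" and \<epsilon>: "real k = 1 / (2 * \<epsilon>)" and div: "real W / real k \<in> \<int>"
  then have "real k > 0"
    by simp
  then have k: "k \<ge> 1"
    by simp
  \<comment> \<open>Integrality of the real quotient is turned into divisibility, so that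
    \<open>W div k\<close> is exact and log W splits into log (W / k) + log k.\<close>
  obtain z where "real W / real k = of_int z"
    using div by (auto elim: Ints_cases)
  then have "real_of_int (int W) = real_of_int (z * int k)"
    using k by (simp add: field_simps)
  then have "int W = z * int k"
    by (simp only: of_int_eq_iff)
  then have "k dvd W"
    by (metis dvd_triv_right of_nat_dvd_iff)
  then have W_eq: "W = W div k * k"
    by simp
  then have n: "W div k \<ge> 1"
    using W by (cases "W div k") auto
  have "log 2 W = log 2 (W div k) + log 2 k"
    using n k by (subst W_eq) (simp add: log_mult)
  then show "\<exists>M. memory_bits W k = enat M \<and> \<bar>real M - (1 / (2 * \<epsilon>) + 2 * log 2 (real W))\<bar> \<le> 8"
    using memory_bits_log[OF n k] \<epsilon> by (metis add.assoc distrib_left)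
qed

end
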